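(* Let $d,q\in\mathbb{N}$, let $\mathbb{X}=[0,1]^d$, let $\mathbb{Y}\subset\mathbb{R}^q$ be compact, and let $\mathbb{Z}=\mathbb{X}\times\mathbb{Y}$. Let $f\in\mathcal{F}$ be a conditional probability density function that is continuous on $\mathbb{Z}$, and let $\psi:\mathbb{R}^q\to[0,\infty)$ be a continuous probability density function on $\mathbb{R}^q$. Then there exists a sequence $\{m_K^\psi\}_{K\in\mathbb{N}}\subset\mathcal{M}_S^\psi$ of soft-max gated mixture of experts models such that, for every $p\in[1,\infty)$, $$\lim_{K\to\infty}\left\Vert f-m_K^\psi\right\Vert_{p,\mathbb{Z}}=0.$$
   Context: $\lambda$ denotes Lebesgue measure (on the space of the relevant dimension), and $[K]=\{1,\dots,K\}$. The class of conditional PDFs is $$\mathcal{F}=\left\{f:\mathbb{Z}\to[0,\infty)\ \Big|\ \int_{\mathbb{Y}}f(\boldsymbol{y}|\boldsymbol{x})\,\mathrm{d}\lambda(\boldsymbol{y})=1\ \text{for all }\boldsymbol{x}\in\mathbb{X}\right\},$$ where $f(\boldsymbol{y}|\boldsymbol{x})$ denotes the value of $f$ at $(\boldsymbol{x},\boldsymbol{y})\in\mathbb{Z}$. For $p\in[1,\infty)$, $\Vert f\Vert_{p,\mathbb{Z}}=\left(\int_{\mathbb{Z}}|f|^p\,\mathrm{d}\lambda\right)^{1/p}$. $\mathcal{L}_\infty$ is the class of essentially bounded functions. A PDF $\psi$ on $\mathbb{R}^q$ is a function $\psi:\mathbb{R}^q\to[0,\infty)$ with $\int_{\mathbb{R}^q}\psi\,\mathrm{d}\lambda=1$.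 The location-scale class generated by $\psi$ is the class $\mathcal{E}_\psi$ of functions $g_\psi(\cdot;\boldsymbol{\mu},\sigma):\mathbb{Y}\to[0,\infty)$, $g_\psi(\boldsymbol{y};\boldsymbol{\mu},\sigma)=\sigma^{-q}\psi\left((\boldsymbol{y}-\boldsymbol{\mu})/\sigma\right)$, with $\boldsymbol{\mu}\in\mathbb{R}^q$, $\sigma\in(0,\infty)$. The soft-max gating class $\mathcal{G}_S^K$ is the set of all vectors $\mathbf{Gate}=(\mathrm{Gate}_k)_{k\in[K]}$ of functions on $\mathbb{X}$ of the form $$\mathrm{Gate}_k(\boldsymbol{x})=\frac{\exp(a_k+\boldsymbol{b}_k^\top\boldsymbol{x})}{\sum_{l=1}^K\exp(a_l+\boldsymbol{b}_l^\top\boldsymbol{x})},\qquad k\in[K],$$ with $a_1,\dots,a_K\in\mathbb{R}$ and $\boldsymbol{b}_1,\dots,\boldsymbol{b}_K\in\mathbb{R}^d$. The class $\mathcal{M}_S^\psi$ of soft-max gated mixture of experts models is the set of all functions $m:\mathbb{Z}\to[0,\infty)$ of the form $$m(\boldsymbol{y}|\boldsymbol{x})=\sum_{k=1}^K\mathrm{Gate}_k(\boldsymbol{x})\,g_\psi(\boldsymbol{y};\boldsymbol{\mu}_k,\sigma_k),$$ with $K\in\mathbb{N}$, $\mathbf{Gate}\in\mathcal{G}_S^K$, $\boldsymbol{\mu}_k\in\mathbb{Y}$, $\sigma_k\in(0,\infty)$, and $g_\psi(\cdot;\boldsymbol{\mu}_k,\sigma_k)\in\mathcal{E}_\psi\cap\mathcal{L}_\infty$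 for $k\in[K]$. *)

theory Defs
  imports "HOL-Analysis.Analysis"
begin

text \<open>
  The ambient spaces \<open>\<real>\<^sup>d\<close> and \<open>\<real>\<^sup>q\<close> are \<open>real ^ 'd\<close> and \<open>real ^ 'q\<close>.  The value written
  \<open>f(y|x)\<close> is \<open>f (x, y)\<close>.  Functions on a subset are total functions of which only the values
  on that subset matter.
\<close>

text \<open>In \<open>real ^ 'd\<close>, the element \<open>1\<close> is the all-ones vector, so this is \<open>[0,1]\<^sup>d\<close>.\<close>

abbreviation unit_cube :: "(real ^ 'd) set" where
  "unit_cube \<equiv> cbox 0 1"

text \<open>
  The Bochner integral of a non-integrable function is \<open>0\<close>, so an integral equal to \<open>1\<close>
  includes integrability, both here and in \<open>is_pdf\<close>.
\<close>

definition cond_pdfs ::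
    "(real ^ 'd) set \<Rightarrow> (real ^ 'q) set \<Rightarrow> ((real ^ 'd) \<times> (real ^ 'q) \<Rightarrow> real) set" where
  "cond_pdfs X Y =
     {f. (\<forall>z\<in>X \<times> Y. 0 \<le> f z) \<and> (\<forall>x\<in>X. (LINT y|lebesgue_on Y. f (x, y)) = 1)}"

definition is_pdf :: "(real ^ 'q \<Rightarrow> real) \<Rightarrow> bool" where
  "is_pdf \<psi> \<longleftrightarrow> (\<forall>y. 0 \<le> \<psi> y) \<and> (LINT y|lebesgue. \<psi> y) = 1"

text \<open>
  The norm is \<open>\<infinity>\<close> when \<open>\<bar>f\<bar>\<^sup>p\<close> has infinite integral; the real-valued power is used only for
  finite integrals.
\<close>

definition Lp_norm :: "real \<Rightarrow> 'a::euclidean_space set \<Rightarrow> ('a \<Rightarrow> real) \<Rightarrow> ennreal" where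
  "Lp_norm p Z f =
     (let I = \<integral>\<^sup>+ z. ennreal (\<bar>f z\<bar> powr p) \<partial>lebesgue_on Z
      in if I = \<infinity> then \<infinity> else ennreal (enn2real I powr (1 / p)))"

definition L_infty :: "'a::euclidean_space set \<Rightarrow> ('a \<Rightarrow> real) set" where
  "L_infty S =
     {g. g \<in> borel_measurable (lebesgue_on S) \<and> (\<exists>C. AE y in lebesgue_on S. \<bar>g y\<bar> \<le> C)}"

definition loc_scale ::
    "(real ^ 'q \<Rightarrow> real) \<Rightarrow> real ^ 'q \<Rightarrow> real \<Rightarrow> real ^ 'q \<Rightarrow> real" where
  "loc_scale \<psi> \<mu> \<sigma> y = inverse (\<sigma> ^ CARD('q)) * \<psi> ((y - \<mu>) /\<^sub>R \<sigma>)"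

definition loc_scale_class :: "(real ^ 'q \<Rightarrow> real) \<Rightarrow> (real ^ 'q \<Rightarrow> real) set" where
  "loc_scale_class \<psi> = {loc_scale \<psi> \<mu> \<sigma> | \<mu> \<sigma>. 0 < \<sigma>}"

definition softmax_gates :: "(real ^ 'd) set \<Rightarrow> nat \<Rightarrow> (nat \<Rightarrow> real ^ 'd \<Rightarrow> real) set" where
  "softmax_gates X K =
     {G. \<exists>(a :: nat \<Rightarrow> real) (b :: nat \<Rightarrow> real ^ 'd). \<forall>k\<in>{1..K}. \<forall>x\<in>X.
           G k x = exp (a k + b k \<bullet> x) / (\<Sum>l=1..K. exp (a l + b l \<bullet> x))}"

text \<open>
  The locations of the experts lie in \<open>Y\<close>, and essential boundedness is required on \<open>Y\<close>, the
  domain of the experts.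
\<close>

definition softmax_moe ::
    "(real ^ 'q \<Rightarrow> real) \<Rightarrow> (real ^ 'd) set \<Rightarrow> (real ^ 'q) set
      \<Rightarrow> ((real ^ 'd) \<times> (real ^ 'q) \<Rightarrow> real) set" where
  "softmax_moe \<psi> X Y =
     {m. \<exists>K\<ge>1. \<exists>G\<in>softmax_gates X K. \<exists>\<mu> \<sigma>.
           (\<forall>k\<in>{1..K}. \<mu> k \<in> Y \<and> 0 < \<sigma> k
              \<and> loc_scale \<psi> (\<mu> k) (\<sigma> k) \<in> loc_scale_class \<psi> \<inter> L_infty Y)
         \<and> (\<forall>x\<in>X. \<forall>y\<in>Y. m (x, y) = (\<Sum>k=1..K. G k x * loc_scale \<psi> (\<mu> k) (\<sigma> k) y))}"

end

theory Submission
  imports Defs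
begin

text \<open>
  Soft-max gates with parameters \<open>b\<^sub>c = 2 t c\<close> and \<open>a\<^sub>c = ln w\<^sub>c - t \<bar>c\<bar>\<^sup>2\<close> are normalised Gaussians
  \<open>w\<^sub>c exp (- t \<bar>x - c\<bar>\<^sup>2)\<close>, since the common factor \<open>exp (t \<bar>x\<bar>\<^sup>2)\<close> cancels.  For a fine finite net
  of centres \<open>c\<close> in \<open>X\<close> and large \<open>t\<close> they concentrate near \<open>x\<close>, so \<open>f (x, y)\<close> is uniformly close to
  \<open>\<Sum>\<^sub>c Gate\<^sub>c(x) f (c, y)\<close>.  This reduces the problem to the finitely many densities \<open>f (c, \<cdot>)\<close> on \<open>Y\<close>.
  Each of them is convolved with \<open>\<sigma>\<^sup>-\<^sup>q \<psi> (\<cdot> / \<sigma>)\<close>, which converges in \<open>L\<^sup>1(Y)\<close> even if \<open>\<partial>Y\<close> has positive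
  measure, and the convolution integral is replaced by a Riemann sum with weights
  \<open>\<integral>\<^sub>A f (c, \<mu>) d\<mu>\<close> over the cells \<open>A\<close> of a partition of \<open>Y\<close>; these weights sum to \<open>1\<close> exactly.
  The mixtures stay below \<open>max f + 1\<close>, so convergence in \<open>L\<^sup>1\<close> gives convergence in all \<open>L\<^sup>p\<close>.
\<close>

subsection \<open>Smoothing of densities on a compact set\<close>

text \<open>Since \<open>g\<close> may jump at the boundary of \<open>Y\<close>, uniform continuity
  is available only inside \<open>Y\<close>. It controls the points of \<open>Y\<close> whose
  translate \<open>y - v\<close> is again in \<open>Y\<close>. At the remaining points
  \<open>g (y - v)\<close> vanishes and the integrand is at most the bound of
  \<open>\<bar>g\<bar>\<close>, so it suffices that these points form a set of small measure, which
  outer regularity provides.\<close>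

lemma L1_continuity_of_translation:
  fixes g :: "'a::euclidean_space \<Rightarrow> real"
  assumes "compact Y" "continuous_on Y g" "\<And>y. y \<notin> Y \<Longrightarrow> g y = 0" "0 < e"
  shows "\<exists>\<delta>>0. \<forall>v. norm v < \<delta> \<longrightarrow>
    (\<integral>\<^sup>+ y. ennreal \<bar>g y - g (y - v)\<bar> * indicator Y y \<partial>lborel) \<le> ennreal e"
proof -
  have Ym[measurable]: "Y \<in> sets borel"
    using assms(1) by (simp add: borel_closed compact_imp_closed)
  have fin: "emeasure lborel Y < \<infinity>"
    using assms(1) by (rule emeasure_compact_finite)
  define l where "l = measure lborel Y"
  have el: "emeasure lborel Y = ennreal l"
    unfolding l_def using fin by (simp add: emeasure_eq_ennreal_measure less_top)
  have l0: "l \<ge> 0" by (simp add: l_def)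
  obtain C where C: "C > 0" "\<And>y. y \<in> Y \<Longrightarrow> \<bar>g y\<bar> \<le> C"
    using compact_imp_bounded[OF compact_continuous_image[OF assms(2,1)]]
    by (auto simp: bounded_pos)
  \<comment> \<open>The tolerance \<open>e\<close> is halved: points that stay in \<open>Y\<close>
    contribute at most \<open>\<eta> * l\<close>, points that leave it at most \<open>C\<close>
    times \<open>e / (2 * C)\<close>. The summand 1 in \<open>l + 1\<close> covers the case that
    \<open>Y\<close> is a null set.\<close>
  define \<eta> where "\<eta> = e / (2 * (l + 1))"
  have \<eta>: "\<eta> > 0" "\<eta> * l \<le> e / 2"
    using assms(4) l0 by (auto simp: \<eta>_def field_simps)
  obtain \<delta>1 where \<delta>1: "\<delta>1 > 0" "\<And>x y. x \<in> Y \<Longrightarrow> y \<in> Y \<Longrightarrow> dist x y < \<delta>1 \<Longrightarrow> dist (g x) (g y) < \<eta>"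
    using compact_uniformly_continuous[OF assms(2,1)] \<eta>(1)
    unfolding uniformly_continuous_on_def by metis
  obtain U where U: "open U" "Y \<subseteq> U" "emeasure lborel (U - Y) < ennreal (e / (2 * C))"
    using outer_regular_lborel[OF Ym, of "e / (2 * C)"] assms(4) C(1)
    by (metis divide_pos_pos mult_pos_pos zero_less_numeral)
  \<comment> \<open>Translates of \<open>Y\<close> by vectors shorter than \<open>\<delta>2\<close>
    remain inside \<open>U\<close>.\<close>
  obtain \<delta>2 where \<delta>2: "\<delta>2 > 0" "(\<Union>x\<in>Y. ball x \<delta>2) \<subseteq> U"
    using compact_subset_open_imp_ball_epsilon_subset[OF assms(1) U(1,2)] by blast
  have Um[measurable]: "U \<in> sets borel" using U(1) by simp
  have main: "(\<integral>\<^sup>+ y. ennreal \<bar>g y - g (y - v)\<bar> * indicator Y y \<partial>lborel) \<le> ennreal e"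
    if v: "norm v < min \<delta>1 \<delta>2" for v
  proof -
    define V where "V = (\<lambda>y. y + v) ` Y"
    have Veq: "V = (\<lambda>y. y - v) -` Y"
      unfolding V_def by (auto simp: image_iff) (metis diff_add_cancel)
    have Vm[measurable]: "V \<in> sets borel"
      unfolding Veq by (rule measurable_sets_borel[OF _ Ym]) measurable
    have V: "V \<subseteq> U"
      using v \<delta>2(2) by (force simp: V_def dist_norm)
    have eV: "emeasure lborel V = emeasure lborel Y"
    proof -
      have "emeasure lborel Y = emeasure (distr lborel borel ((+) (- v))) Y"
        by (subst lborel_distr_plus) simp
      also have "\<dots> = emeasure lborel V"
        by (subst emeasure_distr) (auto simp: Veq vimage_def)
      finally show ?thesis by simp
    qed
    \<comment> \<open>\<open>Y\<close> and its translate \<open>V\<close> have equal measure and both lie in \<open>U\<close>, which exceeds them only slightly.\<close>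
    have "emeasure lborel (Y - V) \<le> emeasure lborel (U - V)"
      using U(2) by (intro emeasure_mono) auto
    also have "\<dots> = emeasure lborel U - emeasure lborel V"
      using V fin eV by (intro emeasure_Diff) auto
    also have "\<dots> = emeasure lborel (U - Y)"
      unfolding eV using U(2) fin by (intro emeasure_Diff[symmetric]) auto
    also have "\<dots> \<le> ennreal (e / (2 * C))"
      using U(3) by (simp add: less_imp_le)
    finally have D: "emeasure lborel (Y - V) \<le> ennreal (e / (2 * C))" .
    have "ennreal \<bar>g y - g (y - v)\<bar> * indicator Y y
        \<le> ennreal \<eta> * indicator Y y + ennreal C * indicator (Y - V) y" for y
    proof (cases "y \<in> Y")
      case True
      show ?thesis
      proof (cases "y \<in> V")
        case True
        then have "y - v \<in> Y" by (simp add: Veq)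
        then have "\<bar>g y - g (y - v)\<bar> \<le> \<eta>"
          using \<delta>1(2)[OF \<open>y \<in> Y\<close>, of "y - v"] v by (simp add: dist_norm)
        then show ?thesis using True \<open>y \<in> Y\<close> by (simp add: ennreal_leI)
      next
        case False
        then have "g (y - v) = 0" using assms(3) by (simp add: Veq)
        then show ?thesis using False \<open>y \<in> Y\<close> C(2)[of y]
          by (simp add: ennreal_leI add_increasing)
      qed
    qed simp
    then have "(\<integral>\<^sup>+ y. ennreal \<bar>g y - g (y - v)\<bar> * indicator Y y \<partial>lborel)
      \<le> (\<integral>\<^sup>+ y. ennreal \<eta> * indicator Y y + ennreal C * indicator (Y - V) y \<partial>lborel)"
      by (intro nn_integral_mono) simp
    also have "\<dots> = ennreal \<eta> * emeasure lborel Y + ennreal C * emeasure lborel (Y - V)"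
      by (subst nn_integral_add) (auto simp: nn_integral_cmult_indicator)
    also have "\<dots> \<le> ennreal (e / 2) + ennreal C * ennreal (e / (2 * C))"
      using D \<eta> l0 by (intro add_mono mult_left_mono) (auto simp: el ennreal_mult[symmetric] ennreal_leI)
    also have "\<dots> = ennreal e"
      using C(1) assms(4) by (simp add: ennreal_mult[symmetric] ennreal_plus[symmetric] del: ennreal_plus)
    finally show ?thesis .
  qed
  show ?thesis
    using main \<delta>1(1) \<delta>2(1) by (intro exI[of _ "min \<delta>1 \<delta>2"]) auto
qed

lemma lborel_integral_affine:
  fixes F :: "'a::euclidean_space \<Rightarrow> real"
  assumes [measurable]: "F \<in> borel_measurable borel" and c: "c \<noteq> 0"
  shows "(LINT x|lborel. F x) = \<bar>c\<bar> ^ DIM('a) * (LINT x|lborel. F (t + c *\<^sub>R x))"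
  by (subst lborel_affine[OF c, of t]) (simp add: integral_density integral_distr)

lemma borel_measurable_continuous_on_compact:
  fixes g :: "'a::euclidean_space \<Rightarrow> real"
  assumes "compact Y" "continuous_on Y g" "\<And>y. y \<notin> Y \<Longrightarrow> g y = 0"
  shows "g \<in> borel_measurable borel"
proof -
  have "(\<lambda>x. indicator Y x *\<^sub>R g x) \<in> borel_measurable borel"
    using assms(1,2) by (intro borel_measurable_continuous_on_indicator) (auto simp: borel_closed compact_imp_closed)
  also have "(\<lambda>x. indicator Y x *\<^sub>R g x) = g"
    using assms(3) by (auto simp: fun_eq_iff indicator_def)
  finally show ?thesis .
qed

text \<open>The substitution \<open>\<mu> = y - s *\<^sub>R u\<close> has a Jacobian that cancels
  the normalising factor of \<open>loc_scale\<close>. The result is an average of translates of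
  \<open>g\<close> with weight \<open>\<psi>\<close>, and the scale appears only in the size of the
  translation.\<close>

lemma integral_loc_scale:
  fixes \<psi> g :: "real ^ 'q \<Rightarrow> real"
  assumes [measurable]: "\<psi> \<in> borel_measurable borel" "g \<in> borel_measurable borel" and s: "0 < s"
  shows "(LINT \<mu>|lborel. loc_scale \<psi> \<mu> s y * g \<mu>) = (LINT u|lborel. \<psi> u * g (y - s *\<^sub>R u))"
proof -
  have [measurable]: "(\<lambda>\<mu>. loc_scale \<psi> \<mu> s y * g \<mu>) \<in> borel_measurable borel"
    unfolding loc_scale_def by measurable
  show ?thesis
    using s by (subst lborel_integral_affine[where c = "- s" and t = y])
      (auto simp: loc_scale_def mult.assoc)
qed

text \<open>As \<open>\<psi>\<close> has mass 1, the error at \<open>y\<close> is a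
  \<open>\<psi>\<close>-average of \<open>g y - g (y - s *\<^sub>R u)\<close>. By Tonelli its L^1
  norm on \<open>Y\<close> is at most the \<open>\<psi>\<close>-average of the translation errors
  \<open>T (s *\<^sub>R u)\<close>. These are bounded and tend to 0 for each \<open>u\<close>, so
  dominated convergence applies.\<close>

lemma smoothing_converges_L1:
  fixes \<psi> g :: "real ^ 'q \<Rightarrow> real"
  assumes Y: "compact Y" and g: "continuous_on Y g" "\<And>y. y \<notin> Y \<Longrightarrow> g y = 0"
    and \<psi>[measurable]: "\<psi> \<in> borel_measurable borel" and \<psi>0: "\<And>y. 0 \<le> \<psi> y" and \<psi>1: "(LINT y|lborel. \<psi> y) = 1"
  shows "(\<lambda>n. \<integral>\<^sup>+ y. ennreal \<bar>g y - (LINT \<mu>|lborel. loc_scale \<psi> \<mu> (1 / real (Suc n)) y * g \<mu>)\<bar> * indicator Y y \<partial>lborel)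
           \<longlonglongrightarrow> 0"
proof -
  have Ym[measurable]: "Y \<in> sets borel"
    using Y by (simp add: borel_closed compact_imp_closed)
  have fin: "emeasure lborel Y < \<infinity>"
    using Y by (rule emeasure_compact_finite)
  have gm[measurable]: "g \<in> borel_measurable borel"
    using borel_measurable_continuous_on_compact[OF Y g] .
  have i\<psi>[simp]: "integrable lborel \<psi>"
    using \<psi>1 not_integrable_integral_eq by fastforce
  have nn\<psi>: "(\<integral>\<^sup>+ u. ennreal (\<psi> u) \<partial>lborel) = 1"
    using \<psi>0 \<psi>1 by (subst nn_integral_eq_integral) auto
  obtain C where C: "C > 0" "\<And>y. \<bar>g y\<bar> \<le> C"
  proof -
    obtain C where "C > 0" "\<And>y. y \<in> Y \<Longrightarrow> \<bar>g y\<bar> \<le> C"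
      using compact_imp_bounded[OF compact_continuous_image[OF g(1) Y]]
      by (auto simp: bounded_pos)
    then show ?thesis using g(2) that[of C] by (metis abs_zero less_imp_le)
  qed
  define T where "T v = (\<integral>\<^sup>+ y. ennreal \<bar>g y - g (y - v)\<bar> * indicator Y y \<partial>lborel)" for v
  have Tm[measurable]: "T \<in> borel_measurable borel"
    unfolding T_def by measurable
  have Tb: "T v \<le> ennreal (2 * C) * emeasure lborel Y" for v
  proof -
    have "T v \<le> (\<integral>\<^sup>+ y. ennreal (2 * C) * indicator Y y \<partial>lborel)"
      unfolding T_def
    proof (intro nn_integral_mono mult_right_mono ennreal_leI)
      show "\<bar>g y - g (y - v)\<bar> \<le> 2 * C" for y
        using C(2)[of y] C(2)[of "y - v"] by linarith
    qed simp
    then show ?thesis by (simp add: nn_integral_cmult_indicator)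
  qed
  have T0: "(T \<longlongrightarrow> 0) (at 0)"
  proof (rule order_tendstoI)
    fix a :: ennreal assume "0 < a"
    then obtain e where e: "0 < e" "ennreal e < a"
      by (metis dense ennreal_0 ennreal_cases ennreal_less_zero_iff less_top_ennreal not_less_zero top_greatest
          less_le_trans ennreal_less_iff linorder_not_less order_less_le)
    obtain \<delta> where "\<delta> > 0" "\<And>v. norm v < \<delta> \<Longrightarrow> T v \<le> ennreal e"
      using L1_continuity_of_translation[OF Y g e(1)] unfolding T_def by auto
    then show "\<forall>\<^sub>F v in at 0. T v < a"
      using e(2) unfolding eventually_at by (metis dist_0_norm dist_commute le_less_trans)
  qed simp
  \<comment> \<open>The value at 0 itself matters: for \<open>u = 0\<close> the argument of
    \<open>T\<close> is constantly 0, so the limit at 0, which ignores that point, must be upgraded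
    to continuity.\<close>
  have T00: "T 0 = 0" by (simp add: T_def)
  have "(\<lambda>n. \<integral>\<^sup>+ u. ennreal (\<psi> u) * T ((1 / real (Suc n)) *\<^sub>R u) \<partial>lborel) \<longlonglongrightarrow> (\<integral>\<^sup>+ u. 0 \<partial>(lborel :: (real^'q) measure))"
  proof (rule nn_integral_dominated_convergence[where w = "\<lambda>u. ennreal (\<psi> u) * (ennreal (2 * C) * emeasure lborel Y)"])
    show "AE u in lborel. ennreal (\<psi> u) * T ((1 / real (Suc n)) *\<^sub>R u) \<le> ennreal (\<psi> u) * (ennreal (2 * C) * emeasure lborel Y)" for n
      using Tb by (intro AE_I2 mult_left_mono) auto
    show "(\<integral>\<^sup>+ u. ennreal (\<psi> u) * (ennreal (2 * C) * emeasure lborel Y) \<partial>lborel) < \<infinity>"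
      using fin by (subst nn_integral_multc) (auto simp: nn\<psi> ennreal_mult_less_top)
    show "AE u in lborel. (\<lambda>n. ennreal (\<psi> u) * T ((1 / real (Suc n)) *\<^sub>R u)) \<longlonglongrightarrow> 0"
    proof (rule AE_I2)
      fix u :: "real ^ 'q"
      have "(\<lambda>n. (1 / real (Suc n)) *\<^sub>R u) \<longlonglongrightarrow> 0 *\<^sub>R u"
        using LIMSEQ_inverse_real_of_nat by (intro tendsto_scaleR tendsto_const) (simp add: inverse_eq_divide)
      moreover have "isCont T 0" unfolding isCont_def using T0 T00 by simp
      ultimately have "(\<lambda>n. T ((1 / real (Suc n)) *\<^sub>R u)) \<longlonglongrightarrow> T 0"
        by (intro isCont_tendsto_compose[of 0 T]) auto
      then have "(\<lambda>n. ennreal (\<psi> u) * T ((1 / real (Suc n)) *\<^sub>R u)) \<longlonglongrightarrow> ennreal (\<psi> u) * T 0"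
        by (intro ennreal_tendsto_cmult) auto
      then show "(\<lambda>n. ennreal (\<psi> u) * T ((1 / real (Suc n)) *\<^sub>R u)) \<longlonglongrightarrow> 0"
        by (simp add: T00)
    qed
  qed auto
  then have lim: "(\<lambda>n. \<integral>\<^sup>+ u. ennreal (\<psi> u) * T ((1 / real (Suc n)) *\<^sub>R u) \<partial>lborel) \<longlonglongrightarrow> 0"
    by simp
  have bound: "(\<integral>\<^sup>+ y. ennreal \<bar>g y - (LINT \<mu>|lborel. loc_scale \<psi> \<mu> s y * g \<mu>)\<bar> * indicator Y y \<partial>lborel)
      \<le> (\<integral>\<^sup>+ u. ennreal (\<psi> u) * T (s *\<^sub>R u) \<partial>lborel)" if s: "0 < s" for s
  proof -
    have "ennreal \<bar>g y - (LINT \<mu>|lborel. loc_scale \<psi> \<mu> s y * g \<mu>)\<bar>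
        \<le> (\<integral>\<^sup>+ u. ennreal (\<psi> u * \<bar>g y - g (y - s *\<^sub>R u)\<bar>) \<partial>lborel)" for y
    proof -
      have [simp]: "integrable lborel (\<lambda>u. \<psi> u * g (y - s *\<^sub>R u))"
      proof (rule Bochner_Integration.integrable_bound[of _ "\<lambda>u. C * \<psi> u"])
        show "AE u in lborel. norm (\<psi> u * g (y - s *\<^sub>R u)) \<le> norm (C * \<psi> u)"
          using C \<psi>0 by (auto simp: abs_mult mult.commute[of C] intro!: mult_left_mono AE_I2)
      qed auto
      \<comment> \<open>Writing \<open>g y\<close> as a \<open>\<psi>\<close>-average puts both
        terms of the error under one integral.\<close>
      have "g y = (LINT u|lborel. \<psi> u * g y)" using \<psi>1 by simp
      then have "g y - (LINT \<mu>|lborel. loc_scale \<psi> \<mu> s y * g \<mu>)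
         = (LINT u|lborel. \<psi> u * g y) - (LINT u|lborel. \<psi> u * g (y - s *\<^sub>R u))"
        by (simp add: integral_loc_scale s)
      also have "\<dots> = (LINT u|lborel. \<psi> u * g y - \<psi> u * g (y - s *\<^sub>R u))"
        by (subst Bochner_Integration.integral_diff) auto
      finally have "ennreal \<bar>g y - (LINT \<mu>|lborel. loc_scale \<psi> \<mu> s y * g \<mu>)\<bar>
        = ennreal (norm (LINT u|lborel. \<psi> u * g y - \<psi> u * g (y - s *\<^sub>R u)))" by simp
      also have "\<dots> \<le> (\<integral>\<^sup>+ u. ennreal (norm (\<psi> u * g y - \<psi> u * g (y - s *\<^sub>R u))) \<partial>lborel)"
        by (intro integral_norm_bound_ennreal Bochner_Integration.integrable_diff) auto
      also have "\<dots> = (\<integral>\<^sup>+ u. ennreal (\<psi> u * \<bar>g y - g (y - s *\<^sub>R u)\<bar>) \<partial>lborel)"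
        using \<psi>0 by (simp add: right_diff_distrib[symmetric] abs_mult)
      finally show ?thesis .
    qed
    then have "(\<integral>\<^sup>+ y. ennreal \<bar>g y - (LINT \<mu>|lborel. loc_scale \<psi> \<mu> s y * g \<mu>)\<bar> * indicator Y y \<partial>lborel)
      \<le> (\<integral>\<^sup>+ y. (\<integral>\<^sup>+ u. ennreal (\<psi> u * \<bar>g y - g (y - s *\<^sub>R u)\<bar>) \<partial>lborel) * indicator Y y \<partial>lborel)"
      by (intro nn_integral_mono mult_right_mono) auto
    also have "\<dots> = (\<integral>\<^sup>+ y. (\<integral>\<^sup>+ u. ennreal (\<psi> u) * (ennreal \<bar>g y - g (y - s *\<^sub>R u)\<bar> * indicator Y y) \<partial>lborel) \<partial>lborel)"
      using \<psi>0 by (subst nn_integral_multc[symmetric]) (auto simp: ennreal_mult mult.assoc)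
    also have "\<dots> = (\<integral>\<^sup>+ u. (\<integral>\<^sup>+ y. ennreal (\<psi> u) * (ennreal \<bar>g y - g (y - s *\<^sub>R u)\<bar> * indicator Y y) \<partial>lborel) \<partial>lborel)"
      by (rule lborel_pair.Fubini') measurable
    also have "\<dots> = (\<integral>\<^sup>+ u. ennreal (\<psi> u) * T (s *\<^sub>R u) \<partial>lborel)"
      unfolding T_def by (subst nn_integral_cmult[symmetric]) auto
    finally show ?thesis .
  qed
  show ?thesis
    by (rule tendsto_sandwich[OF _ _ tendsto_const lim]) (auto intro!: always_eventually bound)
qed

subsection \<open>Finite location-scale mixtures\<close>

text \<open>The balls are made disjoint greedily: the newly inserted centre takes its whole ball
  within \<open>Y\<close>, and the induction hypothesis partitions what is left. Disjointness and
  covering are expressed together by indicators summing to 1, the form in which integrals are split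
  over the cells.\<close>

lemma finite_cover_partition:
  fixes Y :: "'a::metric_space set"
  assumes "finite S" "Y \<subseteq> (\<Union>c\<in>S. ball c \<delta>)" "Y \<in> sets borel"
  shows "\<exists>A. (\<forall>c\<in>S. A c \<in> sets borel \<and> A c \<subseteq> Y \<inter> ball c \<delta>) \<and>
              (\<forall>y\<in>Y. (\<Sum>c\<in>S. indicator (A c) y) = (1::real))"
  using assms
proof (induction S arbitrary: Y rule: finite_induct)
  case empty
  then show ?case by simp
next
  case (insert c S)
  have "Y - ball c \<delta> \<subseteq> (\<Union>c\<in>S. ball c \<delta>)" "Y - ball c \<delta> \<in> sets borel"
    using insert.prems by auto
  from insert.IH[OF this] obtain A where A: "\<And>b. b \<in> S \<Longrightarrow> A b \<in> sets borel"
    "\<And>b. b \<in> S \<Longrightarrow> A b \<subseteq> (Y - ball c \<delta>) \<inter> ball b \<delta>"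
    "\<And>y. y \<in> Y - ball c \<delta> \<Longrightarrow> (\<Sum>b\<in>S. indicator (A b) y) = (1::real)"
    by blast
  let ?A = "A(c := Y \<inter> ball c \<delta>)"
  have rest: "(\<Sum>b\<in>S. indicator (?A b) y) = (\<Sum>b\<in>S. indicator (A b) y :: real)" for y
    using insert.hyps(2) by (intro sum.cong) auto
  have "(\<Sum>b\<in>insert c S. indicator (?A b) y) = (1::real)" if "y \<in> Y" for y
  proof (cases "y \<in> ball c \<delta>")
    case True
    then have "(\<Sum>b\<in>S. indicator (A b) y) = (0::real)"
      using A(2) by (intro sum.neutral) (fastforce simp: indicator_def)
    then show ?thesis
      using True that insert.hyps by (subst sum.insert) (simp_all only: rest, auto)
  next
    case False
    then show ?thesis
      using that insert.hyps A(3)[of y] by (subst sum.insert) (simp_all only: rest, auto)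
  qed
  moreover have "\<forall>b\<in>insert c S. ?A b \<in> sets borel \<and> ?A b \<subseteq> Y \<inter> ball b \<delta>"
    using A(1,2) insert.prems(2) by auto
  ultimately show ?case by blast
qed

lemma integrable_continuous_on_compact:
  fixes g :: "'a::euclidean_space \<Rightarrow> real"
  assumes "compact Y" "continuous_on Y g" "\<And>y. y \<notin> Y \<Longrightarrow> g y = 0"
  shows "integrable lborel g"
proof -
  have "integrable lborel (\<lambda>x. indicator Y x *\<^sub>R g x)"
    using assms(1,2) by (rule borel_integrable_compact)
  also have "(\<lambda>x. indicator Y x *\<^sub>R g x) = g"
    using assms(3) by (auto simp: fun_eq_iff indicator_def)
  finally show ?thesis .
qed

text \<open>This is a Riemann sum over cells so small that \<open>k y\<close> varies by less than
  \<open>e\<close> on each, uniformly in \<open>y\<close>. The weight of a cell is its mass under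
  \<open>g\<close> rather than a value of \<open>g\<close> times a volume; hence the weights sum to
  1 exactly and the total error is at most \<open>e\<close> times the mass 1.\<close>

lemma finite_mixture_uniform_approx:
  fixes g :: "'a::euclidean_space \<Rightarrow> real" and k :: "'a \<Rightarrow> 'a \<Rightarrow> real"
  assumes Y: "compact Y" and g: "continuous_on Y g" "\<And>y. y \<notin> Y \<Longrightarrow> g y = 0"
    and g0: "\<And>y. 0 \<le> g y" and g1: "(LINT y|lborel. g y) = 1"
    and k: "continuous_on (Y \<times> Y) (\<lambda>(y, \<mu>). k y \<mu>)" and e: "0 < e"
  shows "\<exists>J w. finite J \<and> J \<subseteq> Y \<and> (\<forall>c\<in>J. 0 < w c) \<and> sum w J = 1 \<and>
           (\<forall>y\<in>Y. \<bar>(\<Sum>c\<in>J. w c * k y c) - (LINT \<mu>|lborel. k y \<mu> * g \<mu>)\<bar> \<le> e)"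
proof -
  have Ym[measurable]: "Y \<in> sets borel"
    using Y by (simp add: borel_closed compact_imp_closed)
  have gi[simp]: "integrable lborel g"
    using integrable_continuous_on_compact[OF Y g] .
  obtain \<delta> where \<delta>: "\<delta> > 0" "\<And>y c \<mu>. y \<in> Y \<Longrightarrow> c \<in> Y \<Longrightarrow> \<mu> \<in> Y \<Longrightarrow> dist c \<mu> < \<delta> \<Longrightarrow> \<bar>k y c - k y \<mu>\<bar> < e"
  proof -
    have "uniformly_continuous_on (Y \<times> Y) (\<lambda>(y, \<mu>). k y \<mu>)"
      using k Y by (intro compact_uniformly_continuous compact_Times)
    then obtain \<delta> where "\<delta> > 0" and \<delta>: "\<And>z z'. z \<in> Y \<times> Y \<Longrightarrow> z' \<in> Y \<times> Y \<Longrightarrow> dist z' z < \<delta> \<Longrightarrow>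
        dist (case z' of (y, \<mu>) \<Rightarrow> k y \<mu>) (case z of (y, \<mu>) \<Rightarrow> k y \<mu>) < e"
      using e unfolding uniformly_continuous_on_def by metis
    show ?thesis
    proof (rule that[OF \<open>\<delta> > 0\<close>])
      fix y c \<mu> assume "y \<in> Y" "c \<in> Y" "\<mu> \<in> Y" "dist c \<mu> < \<delta>"
      then show "\<bar>k y c - k y \<mu>\<bar> < e"
        \<comment> \<open>The two pairs share the coordinate \<open>y\<close>, so their distance is
          that of \<open>c\<close> and \<open>\<mu>\<close>.\<close>
        using \<delta>[of "(y, \<mu>)" "(y, c)"] by (simp add: dist_Pair_Pair dist_real_def)
    qed
  qed
  obtain S where S: "S \<subseteq> Y" "finite S" "Y \<subseteq> (\<Union>c\<in>S. ball c \<delta>)"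
    using compactE_image[OF Y, of Y "\<lambda>c. ball c \<delta>"] \<delta>(1) by (metis UN_I centre_in_ball open_ball subsetI)
  obtain A where Am[measurable]: "\<And>c. c \<in> S \<Longrightarrow> A c \<in> sets borel"
    and A: "\<And>c. c \<in> S \<Longrightarrow> A c \<subseteq> Y \<inter> ball c \<delta>"
    and A1: "\<And>y. y \<in> Y \<Longrightarrow> (\<Sum>c\<in>S. indicator (A c) y) = (1::real)"
    using finite_cover_partition[OF S(2,3) Ym] by blast
  have ind[simp]: "integrable lborel (\<lambda>\<mu>. indicator (A c) \<mu> * F \<mu>)"
    if "c \<in> S" "integrable lborel F" for c and F :: "'a \<Rightarrow> real"
    using integrable_mult_indicator[of "A c" lborel F] that by simp
  have split: "(LINT \<mu>|lborel. F \<mu>) = (\<Sum>c\<in>S. LINT \<mu>|lborel. indicator (A c) \<mu> * F \<mu>)"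
    if F: "integrable lborel F" "\<And>y. y \<notin> Y \<Longrightarrow> F y = 0" for F :: "'a \<Rightarrow> real"
  proof -
    have "F \<mu> = (\<Sum>c\<in>S. indicator (A c) \<mu> * F \<mu>)" for \<mu>
      using A1[of \<mu>] F(2)[of \<mu>] by (cases "\<mu> \<in> Y") (auto simp: sum_distrib_right[symmetric])
    then have "(LINT \<mu>|lborel. F \<mu>) = (LINT \<mu>|lborel. (\<Sum>c\<in>S. indicator (A c) \<mu> * F \<mu>))"
      by (metis (no_types))
    also have "\<dots> = (\<Sum>c\<in>S. LINT \<mu>|lborel. indicator (A c) \<mu> * F \<mu>)"
      using F(1) by (intro Bochner_Integration.integral_sum) auto
    finally show ?thesis .
  qed
  define w where "w c = (LINT \<mu>|lborel. indicator (A c) \<mu> * g \<mu>)" for c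
  have w0: "0 \<le> w c" for c
    unfolding w_def using g0 by (intro Bochner_Integration.integral_nonneg) auto
  have w1: "sum w S = 1"
    unfolding w_def using split[OF gi g(2)] g1 by simp
  \<comment> \<open>Vanishing weights are dropped, because their logarithm becomes a gating parameter.\<close>
  define J where "J = {c \<in> S. w c \<noteq> 0}"
  have J: "(\<Sum>c\<in>J. w c * F c) = (\<Sum>c\<in>S. w c * F c)" for F :: "'a \<Rightarrow> real"
    unfolding J_def using S(2) by (intro sum.mono_neutral_left) auto
  have "\<bar>(\<Sum>c\<in>S. w c * k y c) - (LINT \<mu>|lborel. k y \<mu> * g \<mu>)\<bar> \<le> e" if y: "y \<in> Y" for y
  proof -
    have "continuous_on Y (\<lambda>\<mu>. (\<lambda>(y, \<mu>). k y \<mu>) (y, \<mu>))"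
      using y by (intro continuous_on_compose2[OF k] continuous_intros) auto
    then have "continuous_on Y (\<lambda>\<mu>. k y \<mu> * g \<mu>)"
      using g(1) by (auto intro: continuous_on_mult)
    then have ki[simp]: "integrable lborel (\<lambda>\<mu>. k y \<mu> * g \<mu>)"
      using g(2) by (intro integrable_continuous_on_compact[OF Y]) auto
    have "(\<Sum>c\<in>S. w c * k y c) - (LINT \<mu>|lborel. k y \<mu> * g \<mu>)
        = (\<Sum>c\<in>S. w c * k y c - (LINT \<mu>|lborel. indicator (A c) \<mu> * (k y \<mu> * g \<mu>)))"
      using split[OF ki] g(2) by (simp add: sum_subtractf)
    \<comment> \<open>With \<open>w c\<close> written as an integral, the error on a cell becomes
      the integral of \<open>(k y c - k y \<mu>) * g \<mu>\<close>, at most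
      \<open>e * w c\<close>.\<close>
    also have "\<dots> = (\<Sum>c\<in>S. LINT \<mu>|lborel. k y c * (indicator (A c) \<mu> * g \<mu>) - indicator (A c) \<mu> * (k y \<mu> * g \<mu>))"
      unfolding w_def
      by (intro sum.cong refl, subst Bochner_Integration.integral_diff) auto
    finally have "\<bar>(\<Sum>c\<in>S. w c * k y c) - (LINT \<mu>|lborel. k y \<mu> * g \<mu>)\<bar>
      \<le> (\<Sum>c\<in>S. \<bar>LINT \<mu>|lborel. k y c * (indicator (A c) \<mu> * g \<mu>) - indicator (A c) \<mu> * (k y \<mu> * g \<mu>)\<bar>)"
      by simp
    also have "\<dots> \<le> (\<Sum>c\<in>S. e * w c)"
    proof (rule sum_mono)
      fix c assume c: "c \<in> S"
      have "\<bar>LINT \<mu>|lborel. k y c * (indicator (A c) \<mu> * g \<mu>) - indicator (A c) \<mu> * (k y \<mu> * g \<mu>)\<bar>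
         \<le> (LINT \<mu>|lborel. \<bar>k y c * (indicator (A c) \<mu> * g \<mu>) - indicator (A c) \<mu> * (k y \<mu> * g \<mu>)\<bar>)"
        by (rule integral_abs_bound)
      also have "\<dots> \<le> (LINT \<mu>|lborel. e * (indicator (A c) \<mu> * g \<mu>))"
      proof (rule integral_mono)
        fix \<mu>
        have "\<bar>k y c - k y \<mu>\<bar> \<le> e" if "\<mu> \<in> A c"
          using \<delta>(2)[OF y, of c \<mu>] subsetD[OF A[OF c] that] S(1) c by (force intro: less_imp_le)
        then have "\<bar>(k y c - k y \<mu>) * g \<mu>\<bar> \<le> e * g \<mu>" if "\<mu> \<in> A c"
          using that g0 by (simp add: abs_mult mult_right_mono)
        then show "\<bar>k y c * (indicator (A c) \<mu> * g \<mu>) - indicator (A c) \<mu> * (k y \<mu> * g \<mu>)\<bar>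
            \<le> e * (indicator (A c) \<mu> * g \<mu>)"
          by (auto simp: indicator_def algebra_simps)
      qed (use c in auto)
      also have "\<dots> = e * w c" by (simp add: w_def)
      finally show "\<bar>LINT \<mu>|lborel. k y c * (indicator (A c) \<mu> * g \<mu>) - indicator (A c) \<mu> * (k y \<mu> * g \<mu>)\<bar> \<le> e * w c" .
    qed
    also have "\<dots> = e" by (simp add: sum_distrib_left[symmetric] w1)
    finally show ?thesis .
  qed
  moreover have "sum w J = 1" using J[of "\<lambda>_. 1"] w1 by simp
  moreover have "finite J" "J \<subseteq> Y" "\<forall>c\<in>J. 0 < w c"
    using S w0 by (auto simp: J_def less_le)
  ultimately show ?thesis using J by (intro exI[of _ J] exI[of _ w]) simp
qed

text \<open>First a scale \<open>s\<close> is fixed for which the smoothed density \<open>h\<close>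
  is within \<open>e / 2\<close> of \<open>g\<close> in L^1; then the integral defining
  \<open>h\<close> is discretised with a uniform error \<open>\<eta>\<close>. The upper bound
  \<open>C + 1\<close> does not depend on \<open>e\<close>, which the later passage to L^p relies
  on.\<close>

lemma finite_mixture_L1_approx:
  fixes \<psi> g :: "real ^ 'q \<Rightarrow> real"
  assumes Y: "compact Y" and g: "continuous_on Y g" "\<And>y. y \<notin> Y \<Longrightarrow> g y = 0"
    and g0: "\<And>y. 0 \<le> g y" and gC: "\<And>y. g y \<le> C" and g1: "(LINT y|lborel. g y) = 1"
    and \<psi>: "continuous_on UNIV \<psi>" and \<psi>0: "\<And>y. 0 \<le> \<psi> y" and \<psi>1: "(LINT y|lborel. \<psi> y) = 1"
    and e: "0 < e"
  shows "\<exists>J w s. finite J \<and> J \<subseteq> Y \<and> 0 < s \<and> (\<forall>c\<in>J. 0 < w c) \<and> sum w J = 1 \<and>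
           (\<forall>y\<in>Y. (\<Sum>c\<in>J. w c * loc_scale \<psi> c s y) \<le> C + 1) \<and>
           (\<integral>\<^sup>+ y. ennreal \<bar>g y - (\<Sum>c\<in>J. w c * loc_scale \<psi> c s y)\<bar> * indicator Y y \<partial>lborel) \<le> ennreal e"
proof -
  have Ym[measurable]: "Y \<in> sets borel"
    using Y by (simp add: borel_closed compact_imp_closed)
  have [measurable]: "\<psi> \<in> borel_measurable borel"
    using \<psi> by (rule borel_measurable_continuous_onI)
  have [measurable]: "g \<in> borel_measurable borel"
    using borel_measurable_continuous_on_compact[OF Y g] .
  have fin: "emeasure lborel Y < \<infinity>"
    using Y by (rule emeasure_compact_finite)
  define l where "l = measure lborel Y"
  have el: "emeasure lborel Y = ennreal l"
    unfolding l_def using fin by (simp add: emeasure_eq_ennreal_measure less_top)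
  have l0: "l \<ge> 0" by (simp add: l_def)
  \<comment> \<open>The entry 1 yields the bound \<open>C + 1\<close> on the mixture; the other
    entry keeps the integrated discretisation error below \<open>e / 2\<close>.\<close>
  define \<eta> where "\<eta> = min 1 (e / (2 * (l + 1)))"
  have \<eta>: "0 < \<eta>" "\<eta> \<le> 1" using e l0 by (auto simp: \<eta>_def)
  have "\<eta> * l \<le> e / (2 * (l + 1)) * l" using l0 by (intro mult_right_mono) (auto simp: \<eta>_def)
  also have "\<dots> \<le> e / 2" using e l0 by (auto simp: field_simps)
  finally have \<eta>l: "\<eta> * l \<le> e / 2" .
  have "\<forall>\<^sub>F n in sequentially. (\<integral>\<^sup>+ y. ennreal \<bar>g y - (LINT \<mu>|lborel. loc_scale \<psi> \<mu> (1 / real (Suc n)) y * g \<mu>)\<bar> * indicator Y y \<partial>lborel) < ennreal (e / 2)"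
    using e by (intro order_tendstoD[OF smoothing_converges_L1[OF Y g _ \<psi>0 \<psi>1]]) auto
  then obtain n where n: "(\<integral>\<^sup>+ y. ennreal \<bar>g y - (LINT \<mu>|lborel. loc_scale \<psi> \<mu> (1 / real (Suc n)) y * g \<mu>)\<bar> * indicator Y y \<partial>lborel) < ennreal (e / 2)"
    by (auto simp: eventually_sequentially)
  define s where "s = 1 / real (Suc n)"
  have s: "0 < s" by (simp add: s_def)
  define h where "h y = (LINT \<mu>|lborel. loc_scale \<psi> \<mu> s y * g \<mu>)" for y
  have hm[measurable]: "h \<in> borel_measurable borel"
    unfolding h_def loc_scale_def by measurable
  have i\<psi>[simp]: "integrable lborel \<psi>"
    using \<psi>1 not_integrable_integral_eq by fastforce
  \<comment> \<open>Smoothing averages values of \<open>g\<close> with weights of mass 1, so it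
    cannot exceed the upper bound of \<open>g\<close>.\<close>
  have hC: "h y \<le> C" for y
  proof -
    have "h y = (LINT u|lborel. \<psi> u * g (y - s *\<^sub>R u))"
      unfolding h_def using s by (intro integral_loc_scale) auto
    also have "\<dots> \<le> (LINT u|lborel. C * \<psi> u)"
    proof (rule integral_mono)
      show "integrable lborel (\<lambda>u. \<psi> u * g (y - s *\<^sub>R u))"
      proof (rule Bochner_Integration.integrable_bound[of _ "\<lambda>u. C * \<psi> u"])
        show "AE u in lborel. norm (\<psi> u * g (y - s *\<^sub>R u)) \<le> norm (C * \<psi> u)"
          using gC g0 order_trans[OF g0 gC] \<psi>0
          by (auto simp: abs_mult mult.commute[of C] intro!: mult_left_mono AE_I2)
      qed auto
      show "\<psi> u * g (y - s *\<^sub>R u) \<le> C * \<psi> u" for u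
        using gC \<psi>0 by (auto simp: mult.commute[of C] intro: mult_left_mono)
    qed auto
    finally show ?thesis using \<psi>1 by simp
  qed
  have "continuous_on (Y \<times> Y) (\<lambda>(y, \<mu>). loc_scale \<psi> \<mu> s y)"
    unfolding loc_scale_def case_prod_unfold
    by (intro continuous_intros continuous_on_compose2[OF \<psi>]) (use s in auto)
  from finite_mixture_uniform_approx[OF Y g g0 g1 this \<eta>(1)]
  obtain J w where J: "finite J" "J \<subseteq> Y" "\<forall>c\<in>J. 0 < w c" "sum w J = 1"
    and M: "\<And>y. y \<in> Y \<Longrightarrow> \<bar>(\<Sum>c\<in>J. w c * loc_scale \<psi> c s y) - h y\<bar> \<le> \<eta>"
    unfolding h_def by blast
  have "ennreal \<bar>g y - (\<Sum>c\<in>J. w c * loc_scale \<psi> c s y)\<bar> * indicator Y y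
     \<le> ennreal \<bar>g y - h y\<bar> * indicator Y y + ennreal \<eta> * indicator Y y" for y
    using M[of y] \<eta>(1)
    by (cases "y \<in> Y") (auto simp: ennreal_plus[symmetric] simp del: ennreal_plus intro!: ennreal_leI)
  then have "(\<integral>\<^sup>+ y. ennreal \<bar>g y - (\<Sum>c\<in>J. w c * loc_scale \<psi> c s y)\<bar> * indicator Y y \<partial>lborel)
    \<le> (\<integral>\<^sup>+ y. ennreal \<bar>g y - h y\<bar> * indicator Y y + ennreal \<eta> * indicator Y y \<partial>lborel)"
    by (intro nn_integral_mono)
  also have "\<dots> = (\<integral>\<^sup>+ y. ennreal \<bar>g y - h y\<bar> * indicator Y y \<partial>lborel) + ennreal \<eta> * emeasure lborel Y"
    by (subst nn_integral_add) (auto simp: nn_integral_cmult_indicator)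
  also have "\<dots> \<le> ennreal (e / 2) + ennreal (e / 2)"
    using n \<eta>l \<eta>(1) l0 unfolding h_def s_def
    by (intro add_mono) (auto simp: el ennreal_mult[symmetric] intro!: ennreal_leI)
  also have "\<dots> = ennreal e"
    using e by (simp add: ennreal_plus[symmetric] del: ennreal_plus)
  finally have "(\<integral>\<^sup>+ y. ennreal \<bar>g y - (\<Sum>c\<in>J. w c * loc_scale \<psi> c s y)\<bar> * indicator Y y \<partial>lborel) \<le> ennreal e" .
  moreover have "(\<Sum>c\<in>J. w c * loc_scale \<psi> c s y) \<le> C + 1" if "y \<in> Y" for y
    using M[OF that] hC[of y] \<eta>(2) by linarith
  ultimately show ?thesis using J s by blast
qed

subsection \<open>Gaussian soft-max gates\<close>

definition gauss_gate :: "'a::real_normed_vector set \<Rightarrow> real \<Rightarrow> 'a \<Rightarrow> 'a \<Rightarrow> real" where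
  "gauss_gate S t c x = exp (- t * (norm (x - c))\<^sup>2) / (\<Sum>c'\<in>S. exp (- t * (norm (x - c'))\<^sup>2))"

lemma gauss_gate_nonneg: "0 \<le> gauss_gate S t c x"
  unfolding gauss_gate_def by (intro divide_nonneg_nonneg sum_nonneg) auto

lemma sum_gauss_gate:
  assumes "finite S" "S \<noteq> {}"
  shows "(\<Sum>c\<in>S. gauss_gate S t c x) = 1"
proof -
  have "(\<Sum>c'\<in>S. exp (- t * (norm (x - c'))\<^sup>2)) > 0"
    using assms by (intro sum_pos) auto
  then show ?thesis
    unfolding gauss_gate_def sum_divide_distrib[symmetric] by simp
qed

text \<open>The gates are convex weights, so the error is a weighted average of
  \<open>f (x, y) - f (c, y)\<close>. Centres closer to \<open>x\<close> than
  \<open>\<delta>\<close> contribute at most \<open>e / 2\<close> by uniform continuity. Farther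
  centres have negligible weight, because the net also has a centre within
  \<open>\<delta> / 2\<close> of \<open>x\<close> whose Gaussian dominates theirs.\<close>

lemma gauss_gate_uniform_approx:
  fixes f :: "'a::real_normed_vector \<times> 'b::metric_space \<Rightarrow> real"
  assumes X: "compact X" "X \<noteq> {}" and Y: "compact Y" and f: "continuous_on (X \<times> Y) f" and e: "0 < e"
  shows "\<exists>S t. finite S \<and> S \<noteq> {} \<and> S \<subseteq> X \<and>
     (\<forall>x\<in>X. \<forall>y\<in>Y. \<bar>f (x, y) - (\<Sum>c\<in>S. gauss_gate S t c x * f (c, y))\<bar> \<le> e)"
proof -
  have XY: "compact (X \<times> Y)" using X Y by (intro compact_Times)
  obtain B where B: "B > 0" "\<And>z. z \<in> X \<times> Y \<Longrightarrow> \<bar>f z\<bar> \<le> B"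
    using compact_imp_bounded[OF compact_continuous_image[OF f XY]] by (auto simp: bounded_pos)
  obtain \<delta> where \<delta>: "\<delta> > 0" and \<delta>': "\<And>z z'. z \<in> X \<times> Y \<Longrightarrow> z' \<in> X \<times> Y \<Longrightarrow> dist z' z < \<delta> \<Longrightarrow> dist (f z') (f z) < e / 2"
    using compact_uniformly_continuous[OF f XY] e unfolding uniformly_continuous_on_def
    by (metis half_gt_zero)
  obtain S where S: "S \<subseteq> X" "finite S" "X \<subseteq> (\<Union>c\<in>S. ball c (\<delta> / 2))"
    using compactE_image[OF X(1), of X "\<lambda>c. ball c (\<delta> / 2)"] \<delta>
    by (metis UN_I centre_in_ball half_gt_zero open_ball subsetI)
  have Sne: "S \<noteq> {}" using S(3) X(2) by auto
  \<comment> \<open>Chosen so that all far centres together contribute at most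
    \<open>card S * 2 * B / K \<le> e / 2\<close>; the added 1 makes \<open>ln K\<close>
    nonnegative.\<close>
  define K where "K = real (card S) * (2 * B) * 2 / e + 1"
  have K: "K \<ge> 1" using B e by (simp add: K_def)
  \<comment> \<open>Solves \<open>exp (- t * \<delta>\<^sup>2) / exp (- t * (\<delta> / 2)\<^sup>2)
    = 1 / K\<close>, the left side being the bound on the gate of a far centre.\<close>
  define t where "t = 4 * ln K / (3 * \<delta>\<^sup>2)"
  have t: "t \<ge> 0" using K by (simp add: t_def)
  have gfar: "gauss_gate S t c x \<le> 1 / K" if x: "x \<in> X" and c: "c \<in> S" "\<delta> \<le> norm (x - c)" for x c
  proof -
    obtain c0 where c0: "c0 \<in> S" "norm (x - c0) \<le> \<delta> / 2"
      using S(3) x by (force simp: dist_norm norm_minus_commute)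
    have "exp (- t * (\<delta> / 2)\<^sup>2) \<le> exp (- t * (norm (x - c0))\<^sup>2)"
      using c0(2) t by (auto intro!: mult_left_mono power_mono)
    also have "\<dots> \<le> (\<Sum>c'\<in>S. exp (- t * (norm (x - c'))\<^sup>2))"
      using c0(1) S(2) by (intro member_le_sum) auto
    finally have den: "exp (- t * (\<delta> / 2)\<^sup>2) \<le> (\<Sum>c'\<in>S. exp (- t * (norm (x - c'))\<^sup>2))" .
    have "exp (- t * (norm (x - c))\<^sup>2) \<le> exp (- t * \<delta>\<^sup>2)"
      using c(2) t \<delta> by (auto intro!: mult_left_mono power_mono)
    then have "gauss_gate S t c x \<le> exp (- t * \<delta>\<^sup>2) / exp (- t * (\<delta> / 2)\<^sup>2)"
      unfolding gauss_gate_def using den by (intro frac_le) auto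
    also have "\<dots> = exp (- t * \<delta>\<^sup>2 - (- t * (\<delta> / 2)\<^sup>2))"
      by (simp only: exp_diff)
    also have "- t * \<delta>\<^sup>2 - (- t * (\<delta> / 2)\<^sup>2) = - ln K"
      using \<delta> by (simp add: t_def field_simps power2_eq_square)
    also have "exp (- ln K) = 1 / K"
      using K by (simp add: exp_minus inverse_eq_divide)
    finally show ?thesis .
  qed
  have "\<bar>f (x, y) - (\<Sum>c\<in>S. gauss_gate S t c x * f (c, y))\<bar> \<le> e" if x: "x \<in> X" and y: "y \<in> Y" for x y
  proof -
    have "f (x, y) - (\<Sum>c\<in>S. gauss_gate S t c x * f (c, y)) = (\<Sum>c\<in>S. gauss_gate S t c x) * f (x, y) - (\<Sum>c\<in>S. gauss_gate S t c x * f (c, y))"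
      by (simp add: sum_gauss_gate S(2) Sne)
    also have "\<dots> = (\<Sum>c\<in>S. gauss_gate S t c x * (f (x, y) - f (c, y)))"
      by (simp add: sum_distrib_right right_diff_distrib sum_subtractf)
    finally have "\<bar>f (x, y) - (\<Sum>c\<in>S. gauss_gate S t c x * f (c, y))\<bar>
       \<le> (\<Sum>c\<in>S. \<bar>gauss_gate S t c x * (f (x, y) - f (c, y))\<bar>)" by simp
    \<comment> \<open>Each term receives the near and the far bound together, so that the sum need
      not be split into near and far centres.\<close>
    also have "\<dots> \<le> (\<Sum>c\<in>S. gauss_gate S t c x * (e / 2) + 1 / K * (2 * B))"
    proof (rule sum_mono)
      fix c assume c: "c \<in> S"
      then have cX: "c \<in> X" using S(1) by auto
      have "\<bar>gauss_gate S t c x * (f (x, y) - f (c, y))\<bar> = gauss_gate S t c x * \<bar>f (x, y) - f (c, y)\<bar>"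
        by (simp add: abs_mult gauss_gate_nonneg)
      also have "\<dots> \<le> gauss_gate S t c x * (e / 2) + 1 / K * (2 * B)"
      proof (cases "\<delta> \<le> norm (x - c)")
        case True
        have "\<bar>f (x, y) - f (c, y)\<bar> \<le> 2 * B"
          using B(2)[of "(x, y)"] B(2)[of "(c, y)"] x y cX by auto
        then have "gauss_gate S t c x * \<bar>f (x, y) - f (c, y)\<bar> \<le> 1 / K * (2 * B)"
          using gfar[OF x c True] B(1) K by (intro mult_mono) auto
        then show ?thesis using gauss_gate_nonneg[of S t c x] e
          by (simp add: add_increasing)
      next
        case False
        then have "dist (x, y) (c, y) < \<delta>" by (simp add: dist_Pair_Pair dist_norm)
        then have "\<bar>f (x, y) - f (c, y)\<bar> \<le> e / 2"
          using \<delta>'[of "(c, y)" "(x, y)"] x y cX by (simp add: dist_real_def)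
        then have "gauss_gate S t c x * \<bar>f (x, y) - f (c, y)\<bar> \<le> gauss_gate S t c x * (e / 2)"
          by (intro mult_left_mono gauss_gate_nonneg)
        moreover have "0 \<le> 1 / K * (2 * B)" using K B by simp
        ultimately show ?thesis by linarith
      qed
      finally show "\<bar>gauss_gate S t c x * (f (x, y) - f (c, y))\<bar> \<le> gauss_gate S t c x * (e / 2) + 1 / K * (2 * B)" .
    qed
    also have "\<dots> = e / 2 + real (card S) * (2 * B) / K"
      by (simp only: sum.distrib sum_distrib_right[symmetric] sum_gauss_gate[OF S(2) Sne]) simp
    also have "real (card S) * (2 * B) / K \<le> e / 2"
      using K e by (simp add: K_def field_simps)
    finally show ?thesis by simp
  qed
  then show ?thesis using S Sne by blast
qed

section \<open>Membership in the soft-max class\<close>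

text \<open>Frees the experts from the index set \<open>{1..K}\<close>: any finite nonempty index
  set is transported along a bijection, which later permits indexing by pairs. Essential boundedness
  of the experts follows from continuity on the compact set \<open>Y\<close>.\<close>

lemma softmax_moeI:
  fixes \<psi> :: "real ^ 'q \<Rightarrow> real" and X :: "(real ^ 'd) set"
  assumes \<psi>: "continuous_on UNIV \<psi>" and Y: "compact Y" and I: "finite I" "I \<noteq> {}"
    and \<mu>: "\<And>i. i \<in> I \<Longrightarrow> \<mu> i \<in> Y" and \<sigma>: "\<And>i. i \<in> I \<Longrightarrow> 0 < \<sigma> i"
    and m: "\<And>x y. x \<in> X \<Longrightarrow> y \<in> Y \<Longrightarrow> m (x, y) =
      (\<Sum>i\<in>I. exp (a i + b i \<bullet> x) / (\<Sum>j\<in>I. exp (a j + b j \<bullet> x)) * loc_scale \<psi> (\<mu> i) (\<sigma> i) y)"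
  shows "m \<in> softmax_moe \<psi> X Y"
proof -
  obtain h where h: "bij_betw h {1..card I} I"
    using ex_bij_betw_nat_finite_1[OF I(1)] by blast
  have hI: "h k \<in> I" if "k \<in> {1..card I}" for k
    using h that by (auto dest: bij_betwE)
  define G where "G k x = exp (a (h k) + b (h k) \<bullet> x) / (\<Sum>l=1..card I. exp (a (h l) + b (h l) \<bullet> x))" for k x
  have G: "G \<in> softmax_gates X (card I)"
    unfolding softmax_gates_def G_def
    by (intro CollectI exI[of _ "a \<circ> h"] exI[of _ "b \<circ> h"]) simp
  have Linf: "loc_scale \<psi> \<mu> \<sigma> \<in> L_infty Y" if "0 < \<sigma>" for \<mu> \<sigma>
  proof -
    have c: "continuous_on Y (loc_scale \<psi> \<mu> \<sigma>)"
      unfolding loc_scale_def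
      by (intro continuous_intros continuous_on_compose2[OF \<psi>]) (use that in auto)
    have "Y \<in> sets lebesgue" using Y by (simp add: lmeasurable_compact fmeasurableD)
    then have "loc_scale \<psi> \<mu> \<sigma> \<in> borel_measurable (lebesgue_on Y)"
      by (rule continuous_imp_measurable_on_sets_lebesgue[OF c])
    moreover obtain B where "\<And>y. y \<in> Y \<Longrightarrow> \<bar>loc_scale \<psi> \<mu> \<sigma> y\<bar> \<le> B"
      using compact_imp_bounded[OF compact_continuous_image[OF c Y]] by (auto simp: bounded_pos)
    ultimately show ?thesis unfolding L_infty_def by (auto intro!: exI[of _ B] AE_I2)
  qed
  have "m (x, y) = (\<Sum>k=1..card I. G k x * loc_scale \<psi> (\<mu> (h k)) (\<sigma> (h k)) y)" if "x \<in> X" "y \<in> Y" for x y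
    unfolding m[OF that] G_def
    by (subst (1 2) sum.reindex_bij_betw[OF h, symmetric]) simp
  moreover have "1 \<le> card I" using I by (simp add: Suc_le_eq card_gt_0_iff)
  moreover have "\<mu> (h k) \<in> Y \<and> 0 < \<sigma> (h k) \<and> loc_scale \<psi> (\<mu> (h k)) (\<sigma> (h k)) \<in> loc_scale_class \<psi> \<inter> L_infty Y"
    if "k \<in> {1..card I}" for k
    using \<mu>[OF hI[OF that]] \<sigma>[OF hI[OF that]] Linf by (auto simp: loc_scale_class_def)
  ultimately show ?thesis
    unfolding softmax_moe_def using G
    by (intro CollectI exI[of _ "card I"] conjI bexI[OF _ G] exI[of _ "\<mu> \<circ> h"] exI[of _ "\<sigma> \<circ> h"]) auto
qed

text \<open>A gated mixture of mixtures is flattened to one mixture indexed by pairs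
  \<open>(c, j)\<close>. The inner weight enters the gate as an additive constant
  \<open>ln (w c j)\<close>, hence the positivity assumption; all experts of the same
  \<open>c\<close> share the slope \<open>2 * t * c\<close> and the scale
  \<open>s c\<close>.\<close>

lemma gauss_gate_mixture_in_softmax_moe:
  fixes \<psi> :: "real ^ 'q \<Rightarrow> real" and S X :: "(real ^ 'd) set"
  assumes \<psi>: "continuous_on UNIV \<psi>" and Y: "compact Y" and S: "finite S" "S \<noteq> {}"
    and J: "\<And>c. c \<in> S \<Longrightarrow> finite (J c)" "\<And>c. c \<in> S \<Longrightarrow> J c \<subseteq> Y" and s: "\<And>c. c \<in> S \<Longrightarrow> 0 < s c"
    and w: "\<And>c j. c \<in> S \<Longrightarrow> j \<in> J c \<Longrightarrow> 0 < w c j" and w1: "\<And>c. c \<in> S \<Longrightarrow> sum (w c) (J c) = 1"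
  shows "(\<lambda>(x, y). \<Sum>c\<in>S. gauss_gate S t c x * (\<Sum>j\<in>J c. w c j * loc_scale \<psi> j (s c) y)) \<in> softmax_moe \<psi> X Y"
proof -
  let ?I = "SIGMA c:S. J c"
  define a where "a = (\<lambda>(c, j). ln (w c j) - t * (norm c)\<^sup>2)"
  define b where "b = (\<lambda>(c :: real ^ 'd, j :: real ^ 'q). (2 * t) *\<^sub>R c)"
  have ab: "exp (a (c, j) + b (c, j) \<bullet> x) = w c j * exp (- t * (norm (x - c))\<^sup>2) * exp (t * (norm x)\<^sup>2)"
    if "c \<in> S" "j \<in> J c" for c j x
  proof -
    have sq: "(norm (x - c))\<^sup>2 = (norm x)\<^sup>2 - 2 * (c \<bullet> x) + (norm c)\<^sup>2"
      by (simp add: power2_norm_eq_inner algebra_simps inner_commute)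
    have "a (c, j) + b (c, j) \<bullet> x = ln (w c j) + - t * (norm (x - c))\<^sup>2 + t * (norm x)\<^sup>2"
      by (subst sq) (simp add: a_def b_def algebra_simps)
    then show ?thesis using w[OF that] by (simp only: exp_add exp_ln)
  qed
  have sI: "(\<Sum>i\<in>?I. F i) = (\<Sum>c\<in>S. \<Sum>j\<in>J c. F (c, j))" for F :: "(real ^ 'd) \<times> (real ^ 'q) \<Rightarrow> real"
    using S J by (subst sum.Sigma) auto
  \<comment> \<open>Summing over \<open>j\<close> first removes the inner weights, as they add up to
    1 for each \<open>c\<close>. The remaining factor \<open>exp (t * (norm x)\<^sup>2)\<close> also
    occurs in every numerator and cancels.\<close>
  have tot: "(\<Sum>i\<in>?I. exp (a i + b i \<bullet> x)) = (\<Sum>c\<in>S. exp (- t * (norm (x - c))\<^sup>2)) * exp (t * (norm x)\<^sup>2)" for x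
    unfolding sI sum_distrib_right
    by (intro sum.cong refl) (simp add: ab sum_distrib_right[symmetric] w1)
  have gate: "exp (a (c, j) + b (c, j) \<bullet> x) / (\<Sum>i\<in>?I. exp (a i + b i \<bullet> x)) = gauss_gate S t c x * w c j"
    if "c \<in> S" "j \<in> J c" for c j x
    unfolding tot ab[OF that] gauss_gate_def by simp
  \<comment> \<open>An empty \<open>J c\<close> would have weight sum 0 instead of 1.\<close>
  have "?I \<noteq> {}"
    using S(2) w1 by (metis (no_types, lifting) Sigma_empty_iff ex_in_conv sum.empty zero_neq_one)
  moreover have "finite ?I" using S J by auto
  moreover have "j \<in> Y" if "c \<in> S" "j \<in> J c" for c j
    using J(2) that by blast
  ultimately show ?thesis
  proof (intro softmax_moeI[OF \<psi> Y, where I = ?I and a = a and b = b and \<mu> = snd and \<sigma> = "\<lambda>(c, j). s c"])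
    fix x y assume "y \<in> Y"
    have "(\<Sum>i\<in>?I. exp (a i + b i \<bullet> x) / (\<Sum>j\<in>?I. exp (a j + b j \<bullet> x)) * loc_scale \<psi> (snd i) (case i of (c, j) \<Rightarrow> s c) y)
      = (\<Sum>c\<in>S. \<Sum>j\<in>J c. gauss_gate S t c x * w c j * loc_scale \<psi> j (s c) y)"
      by (subst sI, intro sum.cong refl) (simp add: gate)
    then show "(case (x, y) of (x, y) \<Rightarrow> \<Sum>c\<in>S. gauss_gate S t c x * (\<Sum>j\<in>J c. w c j * loc_scale \<psi> j (s c) y))
      = (\<Sum>i\<in>?I. exp (a i + b i \<bullet> x) / (\<Sum>j\<in>?I. exp (a j + b j \<bullet> x)) * loc_scale \<psi> (snd i) (case i of (c, j) \<Rightarrow> s c) y)"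
      by (simp add: sum_distrib_left mult.assoc)
  qed (use s in auto)
qed

subsection \<open>Approximation by mixtures of experts\<close>

lemma nn_integral_lborel_snd_times_indicator:
  fixes u :: "'b::euclidean_space \<Rightarrow> ennreal" and X :: "'a::euclidean_space set"
  assumes [measurable]: "u \<in> borel_measurable borel" "X \<in> sets borel"
  shows "(\<integral>\<^sup>+ z. u (snd z) * indicator X (fst z) \<partial>lborel) = (\<integral>\<^sup>+ y. u y \<partial>lborel) * emeasure lborel X"
proof -
  have "(\<integral>\<^sup>+ z. u (snd z) * indicator X (fst z) \<partial>lborel)
      = (\<integral>\<^sup>+ z. u (snd z) * indicator X (fst z) \<partial>((lborel :: 'a measure) \<Otimes>\<^sub>M (lborel :: 'b measure)))"
    by (simp add: lborel_prod)
  also have "\<dots> = (\<integral>\<^sup>+ x. (\<integral>\<^sup>+ y. u y * indicator X x \<partial>lborel) \<partial>lborel)"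
    by (subst lborel.nn_integral_fst[symmetric]) auto
  also have "\<dots> = (\<integral>\<^sup>+ y. u y \<partial>lborel) * emeasure lborel X"
    by (simp add: nn_integral_multc nn_integral_cmult_indicator)
  finally show ?thesis .
qed

text \<open>Two errors are added: the gating error, uniformly at most \<open>e1\<close>, and the
  errors of the experts at the finitely many centres, each at most \<open>e2\<close> in L^1 over
  \<open>Y\<close>. The pointwise bound \<open>C + 1\<close> is independent of
  \<open>e\<close>.\<close>

lemma softmax_moe_L1_approx:
  fixes Y :: "(real ^ 'q) set" and X :: "(real ^ 'd) set"
    and f :: "(real ^ 'd) \<times> (real ^ 'q) \<Rightarrow> real" and \<psi> :: "real ^ 'q \<Rightarrow> real"
  assumes X: "compact X" "X \<noteq> {}" and Y: "compact Y"
    and f: "f \<in> cond_pdfs X Y" and fc: "continuous_on (X \<times> Y) f"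
    and fC: "\<And>z. z \<in> X \<times> Y \<Longrightarrow> f z \<le> C"
    and \<psi>: "is_pdf \<psi>" and \<psi>c: "continuous_on UNIV \<psi>" and e: "0 < e"
  shows "\<exists>m\<in>softmax_moe \<psi> X Y. continuous_on (X \<times> Y) m \<and>
    (\<forall>z\<in>X \<times> Y. \<bar>f z - m z\<bar> \<le> C + 1) \<and>
    (\<integral>\<^sup>+ z. ennreal \<bar>f z - m z\<bar> \<partial>lebesgue_on (X \<times> Y)) \<le> ennreal e"
proof -
  have XYm[measurable]: "X \<in> sets borel" "Y \<in> sets borel" "X \<times> Y \<in> sets borel"
    using X Y by (simp_all add: borel_closed compact_imp_closed compact_Times)
  have f0: "\<And>x y. x \<in> X \<Longrightarrow> y \<in> Y \<Longrightarrow> 0 \<le> f (x, y)"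
    and f1: "\<And>x. x \<in> X \<Longrightarrow> (LINT y|lebesgue_on Y. f (x, y)) = 1"
    using f by (auto simp: cond_pdfs_def)
  have \<psi>m[measurable]: "\<psi> \<in> borel_measurable borel"
    using \<psi>c by (rule borel_measurable_continuous_onI)
  have \<psi>0: "\<And>y. 0 \<le> \<psi> y" and \<psi>1: "(LINT y|lborel. \<psi> y) = 1"
    using \<psi> by (auto simp: is_pdf_def integral_completion)
  \<comment> \<open>Over an empty \<open>Y\<close> the conditional densities would integrate to 0. A
    point of the product then gives \<open>0 \<le> C\<close>.\<close>
  have "Y \<noteq> {}"
  proof
    assume "Y = {}"
    then have "lebesgue_on Y = count_space {}"
      by (intro measure_eqI) (auto simp: sets_restrict_space space_restrict_space)
    then show False using X(2) f1 by (auto simp: lebesgue_integral_count_space_finite)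
  qed
  then obtain x0 y0 where "x0 \<in> X" "y0 \<in> Y" using X(2) by blast
  then have C0: "0 \<le> C" using f0[of x0 y0] fC[of "(x0, y0)"] by auto
  \<comment> \<open>Extension by zero turns integrals over \<open>Y\<close> into integrals over the
    whole space, where translations act.\<close>
  define g where "g x y = (if y \<in> Y then f (x, y) else 0)" for x y
  have gY: "continuous_on Y (g x)" if "x \<in> X" for x
  proof -
    have "continuous_on Y (\<lambda>y. f (x, y))"
      using that by (intro continuous_on_compose2[OF fc] continuous_intros) auto
    then show ?thesis by (rule continuous_on_eq) (simp add: g_def)
  qed
  have gout: "y \<notin> Y \<Longrightarrow> g x y = 0" for x y by (simp add: g_def)
  have gm: "g x \<in> borel_measurable borel" if "x \<in> X" for x
    using borel_measurable_continuous_on_compact[OF Y gY[OF that] gout] .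
  have g1: "(LINT y|lborel. g x y) = 1" if "x \<in> X" for x
  proof -
    have "(LINT y|lebesgue_on Y. f (x, y)) = (LINT y|lebesgue. indicator Y y *\<^sub>R f (x, y))"
      by (rule integral_restrict_space) auto
    also have "\<dots> = (LINT y|lebesgue. g x y)"
      by (intro Bochner_Integration.integral_cong) (auto simp: g_def)
    also have "\<dots> = (LINT y|lborel. g x y)"
      using gm[OF that] by (simp add: integral_completion)
    finally show ?thesis using f1[OF that] by simp
  qed
  have finXY: "emeasure lborel (X \<times> Y) < \<infinity>" and finX: "emeasure lborel X < \<infinity>"
    using emeasure_compact_finite[OF compact_Times[OF X(1) Y]] emeasure_compact_finite[OF X(1)] by simp_all
  define L where "L = measure lborel (X \<times> Y)"
  define l where "l = measure lborel X"
  have L: "emeasure lborel (X \<times> Y) = ennreal L" "L \<ge> 0"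
    unfolding L_def using finXY by (auto simp: emeasure_eq_ennreal_measure less_top)
  have l: "emeasure lborel X = ennreal l" "l \<ge> 0"
    unfolding l_def using finX by (auto simp: emeasure_eq_ennreal_measure less_top)
  define e1 where "e1 = e / (2 * (L + 1))"
  have e1: "e1 > 0" "e1 * L \<le> e / 2" using e L(2) by (auto simp: e1_def field_simps)
  obtain S t where S: "finite S" "S \<noteq> {}" "S \<subseteq> X"
    and approx: "\<And>x y. x \<in> X \<Longrightarrow> y \<in> Y \<Longrightarrow> \<bar>f (x, y) - (\<Sum>c\<in>S. gauss_gate S t c x * f (c, y))\<bar> \<le> e1"
    using gauss_gate_uniform_approx[OF X Y fc e1(1)] by blast
  \<comment> \<open>The expert errors are summed over \<open>card S\<close> centres and integrated
    over \<open>X\<close> of measure \<open>l\<close>; this choice keeps the total below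
    \<open>e / 2\<close>, as \<open>e1\<close> does for the gating error.\<close>
  define e2 where "e2 = e / (2 * (real (card S) * (l + 1)))"
  have cS: "real (card S) > 0" using S by (simp add: card_gt_0_iff)
  have e2: "e2 > 0"
    unfolding e2_def using e l(2) cS by (intro divide_pos_pos mult_pos_pos) auto
  have "real (card S) * (e2 * l) = e * l / (2 * (l + 1))"
    using cS by (simp add: e2_def)
  also have "\<dots> \<le> e / 2"
    using e l(2) by (simp add: field_simps)
  finally have e2l: "real (card S) * (e2 * l) \<le> e / 2" .
  define good where "good c J w s \<longleftrightarrow> finite J \<and> J \<subseteq> Y \<and> 0 < s \<and> (\<forall>j\<in>J. 0 < w j) \<and> sum w J = 1 \<and>
      (\<forall>y\<in>Y. (\<Sum>j\<in>J. w j * loc_scale \<psi> j s y) \<le> C + 1) \<and>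
      (\<integral>\<^sup>+ y. ennreal \<bar>g c y - (\<Sum>j\<in>J. w j * loc_scale \<psi> j s y)\<bar> * indicator Y y \<partial>lborel) \<le> ennreal e2"
    for c J w s
  have "\<forall>c\<in>S. \<exists>J w s. good c J w s"
  proof
    fix c assume "c \<in> S"
    then have c: "c \<in> X" using S(3) by auto
    have gb: "0 \<le> g c y" "g c y \<le> C" for y
      using c f0 fC C0 by (auto simp: g_def)
    show "\<exists>J w s. good c J w s"
      unfolding good_def
      by (rule finite_mixture_L1_approx[OF Y gY[OF c] gout gb g1[OF c] \<psi>c \<psi>0 \<psi>1 e2])
  qed
  then obtain J w s where good: "\<forall>c\<in>S. good c (J c) (w c) (s c)"
    by metis
  have JYs: "\<And>c. c \<in> S \<Longrightarrow> finite (J c)" "\<And>c. c \<in> S \<Longrightarrow> J c \<subseteq> Y" "\<And>c. c \<in> S \<Longrightarrow> 0 < s c"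
    and w: "\<And>c j. c \<in> S \<Longrightarrow> j \<in> J c \<Longrightarrow> 0 < w c j" "\<And>c. c \<in> S \<Longrightarrow> sum (w c) (J c) = 1"
    and MC: "\<And>c y. c \<in> S \<Longrightarrow> y \<in> Y \<Longrightarrow> (\<Sum>j\<in>J c. w c j * loc_scale \<psi> j (s c) y) \<le> C + 1"
    and M1: "\<And>c. c \<in> S \<Longrightarrow> (\<integral>\<^sup>+ y. ennreal \<bar>g c y - (\<Sum>j\<in>J c. w c j * loc_scale \<psi> j (s c) y)\<bar> * indicator Y y \<partial>lborel) \<le> ennreal e2"
    using good by (simp_all add: good_def)
  define M where "M c y = (\<Sum>j\<in>J c. w c j * loc_scale \<psi> j (s c) y)" for c y
  define m where "m = (\<lambda>(x, y). \<Sum>c\<in>S. gauss_gate S t c x * M c y)"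
  have mem: "m \<in> softmax_moe \<psi> X Y"
    unfolding m_def M_def using gauss_gate_mixture_in_softmax_moe[OF \<psi>c Y S(1,2) JYs w] .
  have Mcont: "continuous_on UNIV (M c)" if "c \<in> S" for c
    unfolding M_def loc_scale_def
    by (intro continuous_intros continuous_on_compose2[OF \<psi>c]) (use JYs(3)[OF that] in auto)
  have Mm: "M c \<in> borel_measurable borel" if "c \<in> S" for c
    using Mcont[OF that] by (rule borel_measurable_continuous_onI)
  have mcont: "continuous_on (X \<times> Y) m"
  proof -
    have "(\<Sum>c'\<in>S. exp (- t * (norm (x - c'))\<^sup>2)) \<noteq> 0" for x
      using S sum_pos[of S "\<lambda>c'. exp (- t * (norm (x - c'))\<^sup>2)"] by auto
    then show ?thesis
      unfolding m_def case_prod_unfold gauss_gate_def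
      by (intro continuous_intros continuous_on_compose2[OF Mcont]) auto
  qed
  have M0: "0 \<le> M c y" if "c \<in> S" for c y
    unfolding M_def loc_scale_def using w(1)[OF that] JYs(3)[OF that] \<psi>0
    by (intro sum_nonneg mult_nonneg_nonneg) (auto intro: less_imp_le)
  \<comment> \<open>Both \<open>f z\<close> and \<open>m z\<close> lie between 0 and
    \<open>C + 1\<close>.\<close>
  have bound: "\<bar>f z - m z\<bar> \<le> C + 1" if z: "z \<in> X \<times> Y" for z
  proof -
    obtain x y where z': "z = (x, y)" "x \<in> X" "y \<in> Y" using z by auto
    have "0 \<le> m z" using M0 gauss_gate_nonneg by (auto simp: m_def z' intro!: sum_nonneg mult_nonneg_nonneg)
    moreover have "m z \<le> (\<Sum>c\<in>S. gauss_gate S t c x * (C + 1))"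
      unfolding m_def z' using MC z'(3) by (auto simp: M_def intro!: sum_mono mult_left_mono gauss_gate_nonneg)
    moreover have "(\<Sum>c\<in>S. gauss_gate S t c x * (C + 1)) = C + 1"
      by (simp only: sum_distrib_right[symmetric] sum_gauss_gate[OF S(1,2)] mult_1)
    ultimately show ?thesis using f0[OF z'(2,3)] fC[OF z] z'(1) by auto
  qed
  \<comment> \<open>Estimating each gate by 1 makes the expert error independent of
    \<open>x\<close>, so its integral over the product factorises. The price is a factor
    \<open>card S\<close>, accounted for in \<open>e2\<close>.\<close>
  have pt: "\<bar>f (x, y) - m (x, y)\<bar> \<le> e1 + (\<Sum>c\<in>S. \<bar>g c y - M c y\<bar>)" if "x \<in> X" "y \<in> Y" for x y
  proof -
    have "(\<Sum>c\<in>S. gauss_gate S t c x * f (c, y)) - m (x, y) = (\<Sum>c\<in>S. gauss_gate S t c x * (g c y - M c y))"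
      using that by (simp add: m_def g_def right_diff_distrib sum_subtractf)
    also have "\<bar>\<dots>\<bar> \<le> (\<Sum>c\<in>S. \<bar>gauss_gate S t c x * (g c y - M c y)\<bar>)" by (rule sum_abs)
    also have "\<dots> \<le> (\<Sum>c\<in>S. \<bar>g c y - M c y\<bar>)"
    proof (rule sum_mono)
      fix c assume "c \<in> S"
      then have "gauss_gate S t c x \<le> 1"
        using member_le_sum[of c S "\<lambda>c. gauss_gate S t c x"] S sum_gauss_gate[OF S(1,2)]
        by (simp add: gauss_gate_nonneg)
      then show "\<bar>gauss_gate S t c x * (g c y - M c y)\<bar> \<le> \<bar>g c y - M c y\<bar>"
        by (simp add: abs_mult gauss_gate_nonneg mult_left_le_one_le)
    qed
    finally show ?thesis using approx[OF that] by linarith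
  qed
  define u where "u c y = ennreal \<bar>g c y - M c y\<bar> * indicator Y y" for c y
  have um: "u c \<in> borel_measurable borel" if "c \<in> S" for c
  proof -
    have [measurable]: "g c \<in> borel_measurable borel" "M c \<in> borel_measurable borel"
      using gm Mm that S(3) by auto
    show ?thesis unfolding u_def by measurable
  qed
  have um2: "(\<lambda>z :: (real ^ 'd) \<times> (real ^ 'q). u c (snd z) * indicator X (fst z)) \<in> borel_measurable borel" if "c \<in> S" for c
  proof -
    note [measurable] = um[OF that]
    show ?thesis unfolding borel_prod[symmetric] by measurable
  qed
  have "(\<integral>\<^sup>+ z. ennreal \<bar>f z - m z\<bar> \<partial>lebesgue_on (X \<times> Y))
      = (\<integral>\<^sup>+ z. ennreal \<bar>f z - m z\<bar> * indicator (X \<times> Y) z \<partial>lborel)"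
    by (subst nn_integral_restrict_space) (auto simp: nn_integral_completion)
  also have "\<dots> \<le> (\<integral>\<^sup>+ z. ennreal e1 * indicator (X \<times> Y) z + (\<Sum>c\<in>S. u c (snd z) * indicator X (fst z)) \<partial>lborel)"
  proof (rule nn_integral_mono)
    fix z :: "(real ^ 'd) \<times> (real ^ 'q)"
    obtain x y where z: "z = (x, y)" by (cases z)
    show "ennreal \<bar>f z - m z\<bar> * indicator (X \<times> Y) z \<le> ennreal e1 * indicator (X \<times> Y) z + (\<Sum>c\<in>S. u c (snd z) * indicator X (fst z))"
    proof (cases "x \<in> X \<and> y \<in> Y")
      case True
      then have "ennreal \<bar>f z - m z\<bar> \<le> ennreal (e1 + (\<Sum>c\<in>S. \<bar>g c y - M c y\<bar>))"
        using pt z by (intro ennreal_leI) auto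
      also have "\<dots> = ennreal e1 + (\<Sum>c\<in>S. ennreal \<bar>g c y - M c y\<bar>)"
        using e1(1) by (simp add: ennreal_plus sum_nonneg sum_ennreal)
      finally show ?thesis using True z by (simp add: u_def)
    qed (auto simp: z)
  qed
  also have "\<dots> = ennreal e1 * emeasure lborel (X \<times> Y) + (\<Sum>c\<in>S. \<integral>\<^sup>+ z. u c (snd z) * indicator X (fst z) \<partial>(lborel :: ((real ^ 'd) \<times> (real ^ 'q)) measure))"
    using um2 by (subst nn_integral_add) (auto simp: nn_integral_cmult_indicator nn_integral_sum intro!: borel_measurable_sum)
  also have "\<dots> = ennreal e1 * ennreal L + (\<Sum>c\<in>S. (\<integral>\<^sup>+ y. u c y \<partial>lborel) * ennreal l)"
    using um by (simp add: nn_integral_lborel_snd_times_indicator L l)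
  also have "\<dots> \<le> ennreal e1 * ennreal L + (\<Sum>c\<in>S. ennreal e2 * ennreal l)"
    using M1 by (intro add_mono sum_mono mult_right_mono order_refl) (auto simp: u_def M_def)
  also have "\<dots> = ennreal (e1 * L + real (card S) * (e2 * l))"
    using e1 e2 L l cS by (simp add: ennreal_mult[symmetric] ennreal_of_nat_eq_real_of_nat)
  also have "\<dots> \<le> ennreal e"
    using e1 e2l by (intro ennreal_leI) linarith
  finally show ?thesis using mem mcont bound by blast
qed

section \<open>Passage from L^1 to L^p and conclusion\<close>

text \<open>Interpolation between L^1 and the supremum bound: pointwise
  \<open>\<bar>h z\<bar> powr p\<close> is at most
  \<open>B powr (p - 1) * \<bar>h z\<bar>\<close>.\<close>

lemma Lp_norm_le_of_bounded:
  assumes [measurable]: "h \<in> borel_measurable (lebesgue_on Z)"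
    and B: "\<And>z. z \<in> Z \<Longrightarrow> \<bar>h z\<bar> \<le> B" "0 \<le> B" and p: "1 \<le> p"
    and I: "(\<integral>\<^sup>+ z. ennreal \<bar>h z\<bar> \<partial>lebesgue_on Z) \<le> ennreal e" and e: "0 \<le> e"
  shows "Lp_norm p Z h \<le> ennreal ((B powr (p - 1) * e) powr (1 / p))"
proof -
  define J where "J = (\<integral>\<^sup>+ z. ennreal (\<bar>h z\<bar> powr p) \<partial>lebesgue_on Z)"
  have "J \<le> (\<integral>\<^sup>+ z. ennreal (B powr (p - 1)) * ennreal \<bar>h z\<bar> \<partial>lebesgue_on Z)"
    unfolding J_def
  proof (rule nn_integral_mono)
    fix z assume "z \<in> space (lebesgue_on Z)"
    then have "\<bar>h z\<bar> powr (p - 1) * \<bar>h z\<bar> \<le> B powr (p - 1) * \<bar>h z\<bar>"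
      using B p by (intro mult_right_mono powr_mono2) auto
    \<comment> \<open>Zeros of \<open>h\<close> are separated because \<open>powr_diff\<close>
      divides by \<open>\<bar>h z\<bar>\<close>; there both sides are 0, as \<open>0 powr a\<close>
      is 0 for every \<open>a\<close>.\<close>
    moreover have "\<bar>h z\<bar> powr p = \<bar>h z\<bar> powr (p - 1) * \<bar>h z\<bar>"
      using p by (cases "h z = 0") (auto simp: powr_diff)
    ultimately show "ennreal (\<bar>h z\<bar> powr p) \<le> ennreal (B powr (p - 1)) * ennreal \<bar>h z\<bar>"
      by (simp add: ennreal_mult[symmetric] ennreal_leI)
  qed
  also have "\<dots> = ennreal (B powr (p - 1)) * (\<integral>\<^sup>+ z. ennreal \<bar>h z\<bar> \<partial>lebesgue_on Z)"
    by (rule nn_integral_cmult) measurable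
  also have "\<dots> \<le> ennreal (B powr (p - 1)) * ennreal e"
    using I by (rule mult_left_mono) simp
  finally have J: "J \<le> ennreal (B powr (p - 1) * e)"
    using e by (simp add: ennreal_mult)
  \<comment> \<open>Excludes the infinite branch in the definition of
    \<open>Lp_norm\<close>.\<close>
  then have "J \<noteq> \<infinity>" by (auto simp: top_unique)
  moreover have "enn2real J \<le> B powr (p - 1) * e"
    using J e by (simp add: enn2real_leI)
  ultimately show ?thesis
    unfolding Lp_norm_def J_def[symmetric] Let_def
    using p by (auto intro!: ennreal_leI powr_mono2)
qed

theorem theorem1:
  fixes Y :: "(real ^ 'q) set"
    and f :: "(real ^ 'd) \<times> (real ^ 'q) \<Rightarrow> real"
    and \<psi> :: "real ^ 'q \<Rightarrow> real"
  assumes "compact Y"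
    and "f \<in> cond_pdfs unit_cube Y"
    and "continuous_on (unit_cube \<times> Y) f"
    and "is_pdf \<psi>"
    and "continuous_on UNIV \<psi>"
  shows "\<exists>m :: nat \<Rightarrow> (real ^ 'd) \<times> (real ^ 'q) \<Rightarrow> real.
           (\<forall>K. m K \<in> softmax_moe \<psi> unit_cube Y) \<and>
           (\<forall>p\<ge>1. (\<lambda>K. Lp_norm p (unit_cube \<times> Y) (\<lambda>z. f z - m K z)) \<longlonglongrightarrow> 0)"
proof -
  let ?Z = "(unit_cube :: (real ^ 'd) set) \<times> Y"
  have X: "compact (unit_cube :: (real ^ 'd) set)" "(unit_cube :: (real ^ 'd) set) \<noteq> {}"
    by (auto simp: compact_cbox interval_ne_empty_cart less_eq_vec_def box_ne_empty(1))
  have Z: "compact ?Z" using X(1) assms(1) by (intro compact_Times)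
  obtain C where C: "C > 0" "\<And>z. z \<in> ?Z \<Longrightarrow> \<bar>f z\<bar> \<le> C"
    using compact_imp_bounded[OF compact_continuous_image[OF assms(3) Z]] by (auto simp: bounded_pos)
  \<comment> \<open>The index \<open>K\<close> measures accuracy, not the number of experts. One
    sequence serves all \<open>p\<close>, since the choice involves only the L^1 error and a bound
    common to all \<open>K\<close>; \<open>Suc K\<close> keeps the tolerance positive at
    \<open>K = 0\<close>.\<close>
  have "\<forall>K. \<exists>m. m \<in> softmax_moe \<psi> unit_cube Y \<and> continuous_on ?Z m \<and>
    (\<forall>z\<in>?Z. \<bar>f z - m z\<bar> \<le> C + 1) \<and>
    (\<integral>\<^sup>+ z. ennreal \<bar>f z - m z\<bar> \<partial>lebesgue_on ?Z) \<le> ennreal (1 / real (Suc K))"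
    using softmax_moe_L1_approx[OF X assms(1-3) _ assms(4,5), of C "1 / real (Suc K)" for K] C(2)
    by (simp add: abs_le_iff Bex_def)
  from choice[OF this] obtain m where m: "\<And>K. m K \<in> softmax_moe \<psi> unit_cube Y"
    and mc: "\<And>K. continuous_on ?Z (m K)"
    and mC: "\<And>K z. z \<in> ?Z \<Longrightarrow> \<bar>f z - m K z\<bar> \<le> C + 1"
    and mI: "\<And>K. (\<integral>\<^sup>+ z. ennreal \<bar>f z - m K z\<bar> \<partial>lebesgue_on ?Z) \<le> ennreal (1 / real (Suc K))"
    by blast
  have "(\<lambda>K. Lp_norm p ?Z (\<lambda>z. f z - m K z)) \<longlonglongrightarrow> 0" if p: "1 \<le> p" for p
  proof (rule tendsto_sandwich[OF _ _ tendsto_const])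
    have "Lp_norm p ?Z (\<lambda>z. f z - m K z) \<le> ennreal (((C + 1) powr (p - 1) * (1 / real (Suc K))) powr (1 / p))" for K
    proof (rule Lp_norm_le_of_bounded[OF _ mC _ p mI])
      have "continuous_on ?Z (\<lambda>z. f z - m K z)"
        using assms(3) mc by (intro continuous_on_diff)
      then show "(\<lambda>z. f z - m K z) \<in> borel_measurable (lebesgue_on ?Z)"
        using Z by (intro continuous_imp_measurable_on_sets_lebesgue) (auto intro: lmeasurable_compact fmeasurableD)
    qed (use C in auto)
    then show "\<forall>\<^sub>F K in sequentially. Lp_norm p ?Z (\<lambda>z. f z - m K z) \<le> ennreal (((C + 1) powr (p - 1) * (1 / real (Suc K))) powr (1 / p))"
      by simp
    have "(\<lambda>K. (C + 1) powr (p - 1) * (1 / real (Suc K))) \<longlonglongrightarrow> (C + 1) powr (p - 1) * 0"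
      using LIMSEQ_inverse_real_of_nat by (intro tendsto_mult tendsto_const) (simp add: inverse_eq_divide)
    \<comment> \<open>The base tends to 0, so continuity of the power there needs the positive
      exponent \<open>1 / p\<close> and nonnegative bases.\<close>
    then have "(\<lambda>K. ((C + 1) powr (p - 1) * (1 / real (Suc K))) powr (1 / p)) \<longlonglongrightarrow> 0 powr (1 / p)"
      using p by (intro tendsto_powr2 tendsto_const) auto
    then show "(\<lambda>K. ennreal (((C + 1) powr (p - 1) * (1 / real (Suc K))) powr (1 / p))) \<longlonglongrightarrow> 0"
      using tendsto_ennrealI by fastforce
  qed simp
  then show ?thesis using m by blast
qed

end
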